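(* Let $(x^k,s^k)$, $k=1,\ldots,|\mathcal{C}|$, enumerate all elements of $\mathcal{C}$, and for each $k$ let $d_k\in\mathcal{D}$ be the index with $(x^k,s^k)\in\mathcal{C}_{d_k}$. Define $\mathcal{X}^+_k=\{(z_1,z_2,l)\in\mathcal{Z}\times\mathcal{Z}\times\mathcal{L}: x^k_{z_1,z_2,l}=1\}$, $\mathcal{X}^-_k=\{(z_1,z_2,l)\in\mathcal{Z}\times\mathcal{Z}\times\mathcal{L}: x^k_{z_1,z_2,l}=0\}$, $\mathcal{S}^+_k=\{(v,i)\in\mathcal{V}\times\mathcal{I}: s^k_{vi}=1\}$, $\mathcal{S}^-_k=\{(v,i)\in\mathcal{V}\times\mathcal{I}: s^k_{vi}=0\}$, and $$\begin{aligned}o^k(x,s)=&\left(Q(x^k,s^k)-U_{d_k}\right)\Big(\sum_{(z_1,z_2,l)\in\mathcal{X}^+_k}x_{z_1,z_2,l}-\sum_{(z_1,z_2,l)\in\mathcal{X}^-_k}x_{z_1,z_2,l}+\sum_{(v,i)\in\mathcal{S}^+_k}s_{vi}-\sum_{(v,i)\in\mathcal{S}^-_k}s_{vi}\Big)\\&-\left(Q(x^k,s^k)-U_{d_k}\right)\left(|\mathcal{X}^+_k|+|\mathcal{S}^+_k|-1\right)+U_{d_k}+U\Big(|\mathcal{Z}|^2-\sum_{z_1\in\mathcal{Z}}\sum_{z_2\in\mathcal{Z}}x_{z_1,z_2,l(z_1,z_2,d_k)}\Big).\end{aligned}$$ Then the set of cuts $\phi\le o^k(x,s)$, $k=1,\ldots,|\mathcal{C}|$,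 implies $\phi\le Q(x,s)$ for all $(x,s)\in\mathcal{C}$; that is, whenever $(x,s)\in\mathcal{C}$ and $\phi\ge 0$ satisfy $\phi\le o^k(x,s)$ for all $k=1,\ldots,|\mathcal{C}|$, then $\phi\le Q(x,s)$.
   Context: $\mathcal{I}$ (stations), $\mathcal{Z}$ (zones), $\mathcal{L}$ (price levels), $\mathcal{V}$ (vehicles) are finite nonempty sets. $\mathcal{C}$ is the set of pairs $(x,s)$ with $x=(x_{z_1,z_2,l})\in\{0,1\}^{|\mathcal{Z}|\times|\mathcal{Z}|\times|\mathcal{L}|}$ and $s=(s_{vi})\in\{0,1\}^{|\mathcal{V}|\times|\mathcal{I}|}$ such that $\sum_{l\in\mathcal{L}}x_{z_1,z_2,l}=1$ for all $z_1,z_2\in\mathcal{Z}$ and $\sum_{i\in\mathcal{I}}s_{vi}=1$ for all $v\in\mathcal{V}$. Let $\mathcal{X}$ be the (finite) set of all $x$ satisfying the first family of equalities; its elements are listed as $x_d$, $d\in\mathcal{D}=\{1,\ldots,|\mathcal{X}|\}$, and $\mathcal{C}_d=\{(x,s)\in\mathcal{C}: x=x_d\}$, so the $\mathcal{C}_d$ partition $\mathcal{C}$. For $d\in\mathcal{D}$, $l(z_1,z_2,d)\in\mathcal{L}$ denotes the unique level $l$ with $(x_d)_{z_1,z_2,l}=1$. To each $d\in\mathcal{D}$ corresponds a demand distribution $P_d$ with finite support $\{\xi^{nd}\}_{n=1}^{N_d}$ and probabilities $\pi^{nd}$. $Q(x,s,\xi)$ is the real (finite) optimal value of a second-stage (mixed-integer)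 revenue-maximization problem, and for $(x,s)\in\mathcal{C}_d$, $Q(x,s)=\sum_{n=1}^{N_d}\pi^{nd}Q(x,s,\xi^{nd})$. The only assumption is that $Q(x,s)$ is a well-defined bounded real-valued function on $\mathcal{C}$. The constants $U_d$ ($d\in\mathcal{D}$) and $U$ are real numbers with $U_d\ge\max_{(x,s)\in\mathcal{C}_d}Q(x,s)$ and $\infty>U\ge\max_{d\in\mathcal{D}}U_d-\min_{d\in\mathcal{D}}U_d$. *)

theory Defs
  imports "HOL-Probability.Probability_Mass_Function"
begin

text \<open>Zones, price levels, vehicles and stations are the elements of the finite (hence nonempty)
  types \<open>'z\<close>, \<open>'l\<close>, \<open>'v\<close>, \<open>'i\<close>. The 0-1 vectors are real-valued, since the cuts are affine
  functions of their entries.\<close>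

type_synonym ('z, 'l) pricing = "'z \<Rightarrow> 'z \<Rightarrow> 'l \<Rightarrow> real"
type_synonym ('v, 'i) assignment = "'v \<Rightarrow> 'i \<Rightarrow> real"

definition pricings :: "('z::finite, 'l::finite) pricing set" where
  "pricings = {x. (\<forall>z1 z2 l. x z1 z2 l \<in> {0, 1}) \<and> (\<forall>z1 z2. (\<Sum>l\<in>UNIV. x z1 z2 l) = 1)}"

definition assignments :: "('v::finite, 'i::finite) assignment set" where
  "assignments = {s. (\<forall>v i. s v i \<in> {0, 1}) \<and> (\<forall>v. (\<Sum>i\<in>UNIV. s v i) = 1)}"

definition feasible ::
  "(('z::finite, 'l::finite) pricing \<times> ('v::finite, 'i::finite) assignment) set" where
  "feasible = pricings \<times> assignments"

definition feasible_at ::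
  "(nat \<Rightarrow> ('z::finite, 'l::finite) pricing) \<Rightarrow> nat \<Rightarrow>
    (('z, 'l) pricing \<times> ('v::finite, 'i::finite) assignment) set" where
  "feasible_at xd d = {(x, s). (x, s) \<in> feasible \<and> x = xd d}"

definition level ::
  "(nat \<Rightarrow> ('z::finite, 'l::finite) pricing) \<Rightarrow> 'z \<Rightarrow> 'z \<Rightarrow> nat \<Rightarrow> 'l" where
  "level xd z1 z2 d = (THE l. xd d z1 z2 l = 1)"

definition X_plus :: "('z::finite, 'l::finite) pricing \<Rightarrow> ('z \<times> 'z \<times> 'l) set" where
  "X_plus x = {(z1, z2, l). x z1 z2 l = 1}"

definition X_minus :: "('z::finite, 'l::finite) pricing \<Rightarrow> ('z \<times> 'z \<times> 'l) set" where
  "X_minus x = {(z1, z2, l). x z1 z2 l = 0}"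

definition S_plus :: "('v::finite, 'i::finite) assignment \<Rightarrow> ('v \<times> 'i) set" where
  "S_plus s = {(v, i). s v i = 1}"

definition S_minus :: "('v::finite, 'i::finite) assignment \<Rightarrow> ('v \<times> 'i) set" where
  "S_minus s = {(v, i). s v i = 0}"

text \<open>The right-hand side, at \<open>(x, s)\<close>, of the cut generated by the point \<open>(xk, sk)\<close>, whose pricing
  has index \<open>dk\<close> in the enumeration \<open>xd\<close>.\<close>

definition revenue_cut ::
  "(nat \<Rightarrow> ('z::finite, 'l::finite) pricing) \<Rightarrow>
   (('z, 'l) pricing \<Rightarrow> ('v::finite, 'i::finite) assignment \<Rightarrow> real) \<Rightarrow> (nat \<Rightarrow> real) \<Rightarrow> real \<Rightarrow>
   ('z, 'l) pricing \<Rightarrow> ('v, 'i) assignment \<Rightarrow> nat \<Rightarrow>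
   ('z, 'l) pricing \<Rightarrow> ('v, 'i) assignment \<Rightarrow> real" where
  "revenue_cut xd Q Ud U xk sk dk x s =
     (Q xk sk - Ud dk) *
       ((\<Sum>(z1, z2, l)\<in>X_plus xk. x z1 z2 l) - (\<Sum>(z1, z2, l)\<in>X_minus xk. x z1 z2 l)
        + (\<Sum>(v, i)\<in>S_plus sk. s v i) - (\<Sum>(v, i)\<in>S_minus sk. s v i))
     - (Q xk sk - Ud dk) * (real (card (X_plus xk)) + real (card (S_plus sk)) - 1)
     + Ud dk
     + U * ((real CARD('z))\<^sup>2 - (\<Sum>z1\<in>UNIV. \<Sum>z2\<in>UNIV. x z1 z2 (level xd z1 z2 dk)))"

end

theory Submission
  imports Defs
begin

text \<open>
  Every feasible point \<open>(x, s)\<close> generates one of the cuts, and that cut is tight at its own point: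
  its value there is exactly \<open>Q x s\<close>. Hence a \<open>\<phi>\<close> that satisfies the whole family at \<open>(x, s)\<close>
  satisfies in particular \<open>\<phi> \<le> Q x s\<close>.

  The cut consists of \<open>Q - Ud\<close> times an affine function of the distance from the generating point,
  the constant \<open>Ud\<close>, and \<open>U\<close> times a penalty for a different pricing; lemma \<open>revenue_cut_tight\<close>
  evaluates it at distance zero, that is, at the generating point. The signed sum of entries agrees with
  \<open>|X_plus| + |S_plus|\<close> at that point, so \<open>Q - Ud\<close> is multiplied by
  \<open>|X_plus| + |S_plus| - (|X_plus| + |S_plus| - 1) = 1\<close>, and adding \<open>Ud\<close> leaves \<open>Q\<close>. The term with
  factor \<open>U\<close> counts the zone pairs whose price level differs from the one prescribed by the
  generating pricing, and there are none.
\<close>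

text \<open>The number of ones in a 0-1 vector is the sum of its entries, so sum one leaves room for
  a single one. This is what makes the definite description in \<open>level\<close> meaningful.\<close>

lemma zero_one_sum_one_ex1:
  fixes f :: "'a::finite \<Rightarrow> real"
  assumes zero_one: "\<And>a. f a \<in> {0, 1}" and sum_one: "(\<Sum>a\<in>UNIV. f a) = 1"
  shows "\<exists>!a. f a = 1"
proof -
  have "(\<Sum>a\<in>UNIV. f a) = (\<Sum>a\<in>UNIV. if f a = 1 then 1 else 0)"
    using zero_one by (intro sum.cong) auto
  also have "\<dots> = real (card {a. f a = 1})"
    by (simp add: sum.If_cases)
  finally have "card {a. f a = 1} = 1"
    using sum_one by simp
  then obtain b where "{a. f a = 1} = {b}"
    by (rule card_1_singletonE)
  then have "f a = 1 \<longleftrightarrow> a = b" for a by blast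
  then show ?thesis by simp
qed

lemma pricing_at_level:
  assumes "xd d \<in> pricings"
  shows "xd d z1 z2 (level xd z1 z2 d) = 1"
proof -
  have "\<exists>!l. xd d z1 z2 l = 1"
    using assms by (intro zero_one_sum_one_ex1) (auto simp: pricings_def)
  then show ?thesis
    unfolding level_def by (rule theI')
qed

lemma sum_X_plus_self: "(\<Sum>(z1, z2, l)\<in>X_plus x. x z1 z2 l) = real (card (X_plus x))"
proof -
  have "(\<Sum>(z1, z2, l)\<in>X_plus x. x z1 z2 l) = (\<Sum>_\<in>X_plus x. 1)"
    by (rule sum.cong) (auto simp: X_plus_def)
  then show ?thesis by simp
qed

lemma sum_X_minus_self: "(\<Sum>(z1, z2, l)\<in>X_minus x. x z1 z2 l) = 0"
  by (rule sum.neutral) (auto simp: X_minus_def)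

lemma sum_S_plus_self: "(\<Sum>(v, i)\<in>S_plus s. s v i) = real (card (S_plus s))"
proof -
  have "(\<Sum>(v, i)\<in>S_plus s. s v i) = (\<Sum>_\<in>S_plus s. 1)"
    by (rule sum.cong) (auto simp: S_plus_def)
  then show ?thesis by simp
qed

lemma sum_S_minus_self: "(\<Sum>(v, i)\<in>S_minus s. s v i) = 0"
  by (rule sum.neutral) (auto simp: S_minus_def)

text \<open>At the generating point the coefficient of \<open>Q - Ud\<close> collapses to one and the pricing
  penalty, with factor \<open>U\<close>, vanishes.\<close>

lemma revenue_cut_tight:
  fixes s :: "('v::finite, 'i::finite) assignment"
  assumes "xd d \<in> pricings"
  shows "revenue_cut xd Q Ud U (xd d) s d (xd d) s = Q (xd d) s"
  by (simp add: revenue_cut_def sum_X_plus_self sum_X_minus_self sum_S_plus_self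
      sum_S_minus_self pricing_at_level[where xd = xd and d = d, OF assms] power2_eq_square algebra_simps)

theorem proposition3p4:
  fixes xd :: "nat \<Rightarrow> ('z::finite, 'l::finite) pricing"
    and C :: "(('z, 'l) pricing \<times> ('v::finite, 'i::finite) assignment) set"
    and P :: "nat \<Rightarrow> 'xi pmf"
    and N :: "nat \<Rightarrow> nat"
    and \<xi> :: "nat \<Rightarrow> nat \<Rightarrow> 'xi"
    and Q\<xi> :: "('z, 'l) pricing \<Rightarrow> ('v, 'i) assignment \<Rightarrow> 'xi \<Rightarrow> real"
    and Q :: "('z, 'l) pricing \<Rightarrow> ('v, 'i) assignment \<Rightarrow> real"
    and Ud :: "nat \<Rightarrow> real"
    and U :: real
    and xk :: "nat \<Rightarrow> ('z, 'l) pricing"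
    and sk :: "nat \<Rightarrow> ('v, 'i) assignment"
    and dk :: "nat \<Rightarrow> nat"
  defines "C \<equiv> feasible"
  defines "D \<equiv> {1..card (pricings :: ('z, 'l) pricing set)}"
  assumes pricing_enum: "bij_betw xd D pricings"
    and support: "\<And>d. d \<in> D \<Longrightarrow> bij_betw (\<xi> d) {1..N d} (set_pmf (P d))"
    and Q_eq: "\<And>d x s. d \<in> D \<Longrightarrow> (x, s) \<in> feasible_at xd d \<Longrightarrow>
                 Q x s = (\<Sum>n = 1..N d. pmf (P d) (\<xi> d n) * Q\<xi> x s (\<xi> d n))"
    and Q_bounded: "bounded ((\<lambda>(x, s). Q x s) ` C)"
    and Ud_bound: "\<And>d. d \<in> D \<Longrightarrow> Ud d \<ge> Max ((\<lambda>(x, s). Q x s) ` feasible_at xd d)"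
    and U_bound: "U \<ge> Max (Ud ` D) - Min (Ud ` D)"
    and C_enum: "bij_betw (\<lambda>k. (xk k, sk k)) {1..card C} C"
    and dk: "\<And>k. k \<in> {1..card C} \<Longrightarrow> dk k \<in> D \<and> (xk k, sk k) \<in> feasible_at xd (dk k)"
  shows "\<forall>x s \<phi>. (x, s) \<in> C \<longrightarrow> \<phi> \<ge> 0 \<longrightarrow>
           (\<forall>k\<in>{1..card C}. \<phi> \<le> revenue_cut xd Q Ud U (xk k) (sk k) (dk k) x s) \<longrightarrow> \<phi> \<le> Q x s"
proof (intro allI impI)
  fix x s \<phi>
  assume xs: "(x, s) \<in> C"
    and cuts: "\<forall>k\<in>{1..card C}. \<phi> \<le> revenue_cut xd Q Ud U (xk k) (sk k) (dk k) x s"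
  from xs have "(x, s) \<in> (\<lambda>k. (xk k, sk k)) ` {1..card C}"
    using bij_betw_imp_surj_on[OF C_enum] by simp
  then obtain k where k: "k \<in> {1..card C}" "xk k = x" "sk k = s"
    by blast
  have x: "x = xd (dk k)" and "x \<in> pricings"
    using dk[OF k(1)] k(2) by (auto simp: feasible_at_def feasible_def)
  then have "revenue_cut xd Q Ud U (xk k) (sk k) (dk k) x s = Q x s"
    using revenue_cut_tight[of xd "dk k"] k by simp
  then show "\<phi> \<le> Q x s"
    using cuts k(1) by fastforce
qed

end
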